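(* For every integer $t\ge 2$ there are infinitely many positive integers $d$ for which there exists a $d$-regular multigraph $H$ with $\lambda_2(H)=0$ (equivalently $\mu_2(H)=d$), $\kappa(H)=t$, and $m(H)=\frac{d}{t}$.
   Context: Multigraphs are finite, may have multiple edges, and have no loops. For vertices $u,v$, $m(u,v)$ is the number of edges with endpoints $u$ and $v$, and $m(G)=\max m(u,v)$ over all adjacent pairs $u,v$. A multigraph $G$ is $d$-regular if $\sum_{u\in V(G)} m(v,u)=d$ for every vertex $v$. The adjacency matrix $A(G)$ has $(i,j)$ entry $m(v_i,v_j)$, where $V(G)=\{v_1,\dots,v_n\}$; $\lambda_i(G)$ is its $i$-th largest eigenvalue, counted with multiplicity. The Laplacian matrix is $D(G)-A(G)$, where $D(G)$ is the diagonal matrix of vertex degrees, and $\mu_i(G)$ is its $i$-th smallest eigenvalue; for $d$-regular $G$, $\mu_i(G)=d-\lambda_i(G)$. $G$ is $k$-vertex-connected if $G$ has more than $k$ vertices and every subgraph obtained by deleting fewer than $k$ vertices is connected; the vertex-connectivity $\kappa(G)$ is the maximum $k$ such that $G$ is $k$-vertex-connected. *)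

theory Defs
  imports Jordan_Normal_Form.Char_Poly "HOL-Library.Multiset"
begin

record 'a mgraph =
  verts :: "'a set"
  edges :: "'a set multiset"

definition multigraph :: "'a mgraph \<Rightarrow> bool" where
  "multigraph G \<longleftrightarrow> finite (verts G) \<and>
     (\<forall>e \<in># edges G. e \<subseteq> verts G \<and> card e = 2)"

text \<open>Edges have exactly two endpoints, so the multiplicity of a vertex with itself is 0.\<close>

definition edge_mult :: "'a mgraph \<Rightarrow> 'a \<Rightarrow> 'a \<Rightarrow> nat" where
  "edge_mult G u v = count (edges G) {u, v}"

definition adjacent :: "'a mgraph \<Rightarrow> 'a \<Rightarrow> 'a \<Rightarrow> bool" where
  "adjacent G u v \<longleftrightarrow> edge_mult G u v > 0"

text \<open>The maximum is only meaningful for graphs with at least one edge.\<close>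

definition max_mult :: "'a mgraph \<Rightarrow> nat" where
  "max_mult G = Max {edge_mult G u v | u v. u \<in> verts G \<and> v \<in> verts G \<and> adjacent G u v}"

definition vdegree :: "'a mgraph \<Rightarrow> 'a \<Rightarrow> nat" where
  "vdegree G v = (\<Sum>u\<in>verts G. edge_mult G v u)"

definition regular :: "nat \<Rightarrow> 'a mgraph \<Rightarrow> bool" where
  "regular d G \<longleftrightarrow> (\<forall>v\<in>verts G. vdegree G v = d)"

definition vertex_list :: "'a::linorder mgraph \<Rightarrow> 'a list" where
  "vertex_list G = sorted_list_of_set (verts G)"

definition adj_matrix :: "'a::linorder mgraph \<Rightarrow> real mat" where
  "adj_matrix G = mat (card (verts G)) (card (verts G))
     (\<lambda>(i, j). real (edge_mult G (vertex_list G ! i) (vertex_list G ! j)))"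

definition degree_matrix :: "'a::linorder mgraph \<Rightarrow> real mat" where
  "degree_matrix G = mat (card (verts G)) (card (verts G))
     (\<lambda>(i, j). if i = j then real (vdegree G (vertex_list G ! i)) else 0)"

definition laplacian_matrix :: "'a::linorder mgraph \<Rightarrow> real mat" where
  "laplacian_matrix G = degree_matrix G - adj_matrix G"

text \<open>The real eigenvalues in increasing order, each repeated according to its multiplicity as a
  root of the characteristic polynomial. For the symmetric matrices used here these are all the
  eigenvalues, and algebraic and geometric multiplicities agree.\<close>

definition eigenvalue_list :: "real mat \<Rightarrow> real list" where
  "eigenvalue_list A = sorted_list_of_multiset (proots (char_poly A))"

text \<open>Eigenvalues of graphs are indexed from 1. They do not depend on the enumeration of the
  vertices, since a different one conjugates the matrices by a permutation matrix.\<close>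

definition adj_eigenvalue :: "nat \<Rightarrow> 'a::linorder mgraph \<Rightarrow> real" where
  "adj_eigenvalue i G = rev (eigenvalue_list (adj_matrix G)) ! (i - 1)"

definition laplacian_eigenvalue :: "nat \<Rightarrow> 'a::linorder mgraph \<Rightarrow> real" where
  "laplacian_eigenvalue i G = eigenvalue_list (laplacian_matrix G) ! (i - 1)"

definition delete_verts :: "'a mgraph \<Rightarrow> 'a set \<Rightarrow> 'a mgraph" where
  "delete_verts G S =
     \<lparr>verts = verts G - S, edges = filter_mset (\<lambda>e. e \<inter> S = {}) (edges G)\<rparr>"

definition connected_mgraph :: "'a mgraph \<Rightarrow> bool" where
  "connected_mgraph G \<longleftrightarrow>
     (\<forall>u\<in>verts G. \<forall>v\<in>verts G. (u, v) \<in> {(x, y). adjacent G x y}\<^sup>*)"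

definition vertex_connected :: "nat \<Rightarrow> 'a mgraph \<Rightarrow> bool" where
  "vertex_connected k G \<longleftrightarrow> k < card (verts G) \<and>
     (\<forall>S. S \<subseteq> verts G \<and> card S < k \<longrightarrow> connected_mgraph (delete_verts G S))"

definition vertex_connectivity :: "'a mgraph \<Rightarrow> nat" where
  "vertex_connectivity G = Max {k. vertex_connected k G}"

end

theory Submission imports Defs begin

text \<open>Take \<open>H\<close> to be \<open>K\<^bsub>t,t\<^esub>\<close> with every edge repeated \<open>k\<close> times. It is
  \<open>kt\<close>-regular with adjacency eigenvalues \<open>kt, 0, \<dots>, 0, -kt\<close>, hence Laplacian eigenvalues
  \<open>0, kt, \<dots>, kt, 2kt\<close>, and \<open>k \<ge> 1\<close> is arbitrary.\<close>

subsection \<open>Eigenvalues of the matrix of a balanced complete bipartite graph\<close>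

text \<open>Similar matrices share their characteristic polynomial, and that of a triangular matrix
  splits into linear factors over its diagonal, so the roots with multiplicity are the diagonal
  entries.\<close>

lemma eigenvalue_list_upper_triangular:
  assumes "similar_mat A B" "upper_triangular B" "B \<in> carrier_mat n n"
  shows "eigenvalue_list A = sort (diag_mat B)"
proof -
  have "proots (\<Prod>a\<leftarrow>as. [:- a, 1:]) = mset as" for as :: "real list"
  proof (induction as)
    case (Cons a as)
    have "(\<Prod>a\<leftarrow>as. [:- a, 1:]) \<noteq> 0"
      by (auto simp: prod_list_zero_iff)
    then have "proots ([:- a, 1:] * (\<Prod>a\<leftarrow>as. [:- a, 1:])) = {#a#} + mset as"
      by (subst proots_mult) (simp_all add: Cons.IH)
    then show ?case by simp
  qed simp
  then show ?thesis
    unfolding eigenvalue_list_def char_poly_similar[OF assms(1)]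
      char_poly_upper_triangular[OF assms(3,2)]
    by simp
qed

text \<open>This is \<open>x\<close> times the identity plus \<open>y\<close> times the adjacency
  matrix of \<open>K_{t,t}\<close> with parts given by parity. The adjacency matrix of the example
  (\<open>x = 0\<close>, \<open>y = k\<close>) and its Laplacian (\<open>x = k * t\<close>,
  \<open>y = - k\<close>) are both of this form.\<close>

definition parity_mat :: "nat \<Rightarrow> real \<Rightarrow> real \<Rightarrow> real mat" where
  "parity_mat t x y = mat (2 * t) (2 * t)
     (\<lambda>(i, j). (if i = j then x else 0) + (if even i \<noteq> even j then y else 0))"

text \<open>The matrix of \<^term>\<open>parity_mat t x y\<close> in the basis consisting of the all-ones vector, the
  indicator of the odd indices, and the unit vectors \<open>e\<^sub>j\<close> for \<open>j \<ge> 2\<close>.\<close>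

definition parity_tri :: "nat \<Rightarrow> real \<Rightarrow> real \<Rightarrow> real mat" where
  "parity_tri t x y = mat (2 * t) (2 * t) (\<lambda>(i, j).
     (if i = 0 then (if j = 0 then x + real t * y else if j = 1 then real t * y
        else if odd j then y else 0) else 0) +
     (if i = 1 then (if j = 0 then 0 else if j = 1 then x - real t * y
        else if odd j then - y else y) else 0) +
     (if i = j then (if 2 \<le> j then x else 0) else 0))"

text \<open>The basis vectors are the columns. In this order the matrix is lower triangular with
  unit diagonal, hence invertible.\<close>

definition parity_basis :: "nat \<Rightarrow> real mat" where
  "parity_basis t = mat (2 * t) (2 * t) (\<lambda>(i, j).
     if j = 0 then 1 else if j = 1 then (if odd i then 1 else 0) else if i = j then 1 else 0)"

lemma card_even_odd_below:
  "card {i. i < 2 * t \<and> even i} = t" "card {i. i < 2 * t \<and> odd i} = t"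
proof -
  have "{i. i < 2 * t \<and> even i} = (\<lambda>i. 2 * i) ` {..<t}"
    by (auto elim!: evenE)
  then show "card {i. i < 2 * t \<and> even i} = t"
    by (simp add: card_image inj_on_def)
  have "{i. i < 2 * t \<and> odd i} = (\<lambda>i. 2 * i + 1) ` {..<t}"
    by (auto elim!: oddE)
  then show "card {i. i < 2 * t \<and> odd i} = t"
    by (simp add: card_image inj_on_def)
qed

lemma sum_even_odd_below:
  fixes c :: "'a::semiring_1"
  shows "(\<Sum>i = 0..<2 * t. if even i then c else 0) = of_nat t * c"
    "(\<Sum>i = 0..<2 * t. if odd i then c else 0) = of_nat t * c"
proof -
  have *: "{0..<2 * t} \<inter> {i. even i} = {i. i < 2 * t \<and> even i}"
    "{0..<2 * t} \<inter> - {i. even i} = {i. i < 2 * t \<and> odd i}" by auto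
  show "(\<Sum>i = 0..<2 * t. if even i then c else 0) = of_nat t * c"
    by (simp add: sum.If_cases * card_even_odd_below)
  have "(\<Sum>i = 0..<2 * t. if odd i then c else 0) = (\<Sum>i = 0..<2 * t. if even i then 0 else c)"
    by (intro sum.cong) auto
  then show "(\<Sum>i = 0..<2 * t. if odd i then c else 0) = of_nat t * c"
    by (simp add: sum.If_cases * card_even_odd_below)
qed

text \<open>Let \<open>o\<close> be the indicator of the odd indices. The parity part of the matrix
  sends the all-ones vector \<open>1\<close> to \<open>t y 1\<close>, sends \<open>o\<close> to
  \<open>t y (1 - o)\<close>, and sends a unit vector to \<open>y\<close> times the indicator of the
  opposite part, which is \<open>1 - o\<close> or \<open>o\<close>.\<close>

lemma parity_mat_basis:
  assumes "t > 0"
  shows "parity_mat t x y * parity_basis t = parity_basis t * parity_tri t x y" (is "?M * ?P = ?P * ?D")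
proof (rule eq_matI)
  fix i j assume "i < dim_row (?P * ?D)" "j < dim_col (?P * ?D)"
  then have ij: "i < 2 * t" "j < 2 * t" by (auto simp: parity_basis_def parity_tri_def)
  define p where "p = (\<lambda>i j :: nat. if j = 0 then 1 else if j = 1 then (if odd i then 1 else 0)
    else if i = j then 1 else 0 :: real)"
  have P: "?P $$ (k, l) = p k l" if "k < 2 * t" "l < 2 * t" for k l
    using that by (simp add: parity_basis_def p_def)
  have "(?M * ?P) $$ (i, j) = (\<Sum>k = 0..<2 * t. ?M $$ (i, k) * ?P $$ (k, j))"
    using ij by (auto simp: parity_mat_def parity_basis_def scalar_prod_def intro!: sum.cong)
  also have "\<dots> = (\<Sum>k = 0..<2 * t.
      (if k = i then x * p i j else 0) + (if even i \<noteq> even k then y * p k j else 0))"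
    using ij by (intro sum.cong refl) (auto simp: P parity_mat_def algebra_simps)
  also have "\<dots> = x * p i j + (\<Sum>k = 0..<2 * t. if even i \<noteq> even k then y * p k j else 0)"
    using ij by (simp add: sum.distrib)
  \<comment> \<open>This is the action of the parity part on column \<open>j\<close>; the factor
    \<open>t\<close> counts the indices of one parity.\<close>
  also have "(\<Sum>k = 0..<2 * t. if even i \<noteq> even k then y * p k j else 0) =
      (if j = 0 then real t * y else if j = 1 then (if even i then real t * y else 0)
       else if even i \<noteq> even j then y else 0)"
  proof -
    consider "j = 0" | "j = 1" | "j \<ge> 2" by linarith
    then show ?thesis
    proof cases
      case 1
      have "(\<Sum>k = 0..<2 * t. if even i \<noteq> even k then y * p k j else 0) =
          (\<Sum>k = 0..<2 * t. if even i \<noteq> even k then y else 0)"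
        using 1 by (intro sum.cong) (auto simp: p_def)
      then show ?thesis
        using 1 by (cases "even i") (simp_all add: sum_even_odd_below)
    next
      case 2
      have "(\<Sum>k = 0..<2 * t. if even i \<noteq> even k then y * p k j else 0) =
          (\<Sum>k = 0..<2 * t. if odd k then (if even i then y else 0) else 0)"
        using 2 by (intro sum.cong) (auto simp: p_def)
      then show ?thesis
        using 2 by (simp add: sum_even_odd_below)
    next
      case 3
      have "(\<Sum>k = 0..<2 * t. if even i \<noteq> even k then y * p k j else 0) =
          (\<Sum>k = 0..<2 * t. if k = j then (if even i \<noteq> even j then y else 0) else 0)"
        using 3 by (intro sum.cong) (auto simp: p_def)
      then show ?thesis
        using 3 ij by simp
    qed
  qed
  finally have lhs: "(?M * ?P) $$ (i, j) = x * p i j + \<dots>" .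
  have "(?P * ?D) $$ (i, j) = (\<Sum>k = 0..<2 * t. ?P $$ (i, k) * ?D $$ (k, j))"
    using ij by (auto simp: parity_tri_def parity_basis_def scalar_prod_def intro!: sum.cong)
  \<comment> \<open>Each summand is supported at a single \<open>k\<close>, namely 0, 1 or
    \<open>j\<close>, so the sum collapses to three terms.\<close>
  also have "\<dots> = (\<Sum>k = 0..<2 * t.
     (if k = 0 then p i 0 * (if j = 0 then x + real t * y else if j = 1 then real t * y
        else if odd j then y else 0) else 0) +
     (if k = 1 then p i 1 * (if j = 0 then 0 else if j = 1 then x - real t * y
        else if odd j then - y else y) else 0) +
     (if k = j then p i j * (if 2 \<le> j then x else 0) else 0))"
    using ij by (intro sum.cong refl) (auto simp: P parity_tri_def algebra_simps)
  also have "\<dots> = p i 0 * (if j = 0 then x + real t * y else if j = 1 then real t * y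
        else if odd j then y else 0) +
     p i 1 * (if j = 0 then 0 else if j = 1 then x - real t * y
        else if odd j then - y else y) +
     p i j * (if 2 \<le> j then x else 0)"
    using ij assms by (simp add: sum.distrib)
  finally show "(?M * ?P) $$ (i, j) = (?P * ?D) $$ (i, j)"
    unfolding lhs by (auto simp: p_def algebra_simps)
qed (auto simp: parity_mat_def parity_basis_def parity_tri_def)

lemma similar_parity_mat:
  assumes "t > 0"
  shows "similar_mat (parity_mat t x y) (parity_tri t x y)"
proof -
  let ?n = "2 * t" and ?M = "parity_mat t x y" and ?P = "parity_basis t" and ?D = "parity_tri t x y"
  have carr: "?M \<in> carrier_mat ?n ?n" "?P \<in> carrier_mat ?n ?n" "?D \<in> carrier_mat ?n ?n"
    by (auto simp: parity_mat_def parity_basis_def parity_tri_def)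
  have "det ?P = prod_list (diag_mat ?P)"
    by (rule det_lower_triangular[OF _ carr(2)]) (auto simp: parity_basis_def)
  also have "\<dots> = 1"
    unfolding prod_list_diag_prod
    by (rule prod.neutral) (auto simp: parity_basis_def)
  finally have "det ?P \<noteq> 0" by simp
  \<comment> \<open>Being a unit of the matrix ring yields a two-sided inverse; \<open>()\<close>
    fills the extension slot of the ring record.\<close>
  from det_non_zero_imp_unit[OF carr(2) this, of "()"]
  obtain Q where Q: "Q \<in> carrier_mat ?n ?n" "Q * ?P = 1\<^sub>m ?n" "?P * Q = 1\<^sub>m ?n"
    by (auto simp: Units_def ring_mat_def)
  have "?P * ?D * Q = ?M * ?P * Q" by (simp add: parity_mat_basis[OF assms])
  also have "\<dots> = ?M" using carr Q by (simp add: assoc_mult_mat[OF carr(1,2) Q(1)])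
  finally show ?thesis
    using carr Q by (intro similar_matI[of _ _ ?P Q ?n]) auto
qed

lemma eigenvalue_list_parity_mat:
  assumes "t > 0"
  shows "eigenvalue_list (parity_mat t x y) =
    sort ([x + real t * y, x - real t * y] @ replicate (2 * t - 2) x)"
proof -
  have "diag_mat (parity_tri t x y) =
      [x + real t * y, x - real t * y] @ replicate (2 * t - 2) x"
  proof (rule nth_equalityI)
    fix i assume "i < length (diag_mat (parity_tri t x y))"
    then have i: "i < 2 * t" by (simp add: diag_mat_def parity_tri_def)
    consider "i = 0" | "i = 1" | k where "i = Suc (Suc k)"
      by (metis One_nat_def not0_implies_Suc)
    then show "diag_mat (parity_tri t x y) ! i =
        ([x + real t * y, x - real t * y] @ replicate (2 * t - 2) x) ! i"
      using i by cases (auto simp: diag_mat_def parity_tri_def)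
  qed (use assms in \<open>auto simp: diag_mat_def parity_tri_def\<close>)
  moreover have "upper_triangular (parity_tri t x y)"
    by (auto simp: upper_triangular_def parity_tri_def)
  ultimately show ?thesis
    using eigenvalue_list_upper_triangular[OF similar_parity_mat[OF assms], of x y "2 * t"]
    by (simp add: parity_tri_def)
qed

text \<open>The extreme eigenvalues are \<open>x - t|y|\<close> and \<open>x + t|y|\<close>. All
  others equal \<open>x\<close>, and \<open>t \<ge> 2\<close> ensures that there are some, so
  \<open>x\<close> is second from either end.\<close>

lemma second_eigenvalues_parity_mat:
  assumes "t \<ge> 2"
  shows "eigenvalue_list (parity_mat t x y) ! 1 = x"
    and "rev (eigenvalue_list (parity_mat t x y)) ! 1 = x"
proof -
  \<comment> \<open>The absolute value handles both signs of \<open>y\<close>, as the Laplacian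
    needs a negative one.\<close>
  define a where "a = real t * \<bar>y\<bar>"
  have "a \<ge> 0" by (simp add: a_def)
  let ?xs = "[x - a] @ replicate (2 * t - 2) x @ [x + a]"
  have "mset ?xs = mset ([x + real t * y, x - real t * y] @ replicate (2 * t - 2) x)"
    by (cases "y \<ge> 0") (auto simp: a_def)
  moreover have "sorted ?xs"
    using \<open>a \<ge> 0\<close> by (auto simp: sorted_append)
  ultimately have "sort ([x + real t * y, x - real t * y] @ replicate (2 * t - 2) x) = ?xs"
    by (rule properties_for_sort)
  then have eq: "eigenvalue_list (parity_mat t x y) = ?xs"
    using assms by (simp only: eigenvalue_list_parity_mat)
  obtain m where m: "2 * t - 2 = Suc m"
    using assms by (cases "2 * t - 2") auto
  show "eigenvalue_list (parity_mat t x y) ! 1 = x"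
    and "rev (eigenvalue_list (parity_mat t x y)) ! 1 = x"
    unfolding eq m by (simp_all add: nth_append)
qed

subsection \<open>Balanced complete bipartite multigraphs\<close>

text \<open>The vertices form an initial segment of the naturals, so \<open>vertex_list\<close>
  enumerates each vertex at its own index and matrix indices can be read as vertices.\<close>

definition bipartite_mgraph :: "nat \<Rightarrow> nat \<Rightarrow> nat mgraph" where
  "bipartite_mgraph t k = \<lparr>verts = {..<2 * t}, edges = repeat_mset k
     (mset_set {{u, v} | u v. u < 2 * t \<and> v < 2 * t \<and> even u \<and> odd v})\<rparr>"

lemma verts_bipartite [simp]: "verts (bipartite_mgraph t k) = {..<2 * t}"
  by (simp add: bipartite_mgraph_def)

lemma finite_bipartite_edges:
  "finite {{u, v} | u v :: nat. u < 2 * t \<and> v < 2 * t \<and> even u \<and> odd v}"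
  by (rule finite_subset[of _ "Pow {..<2 * t}"]) auto

lemma multigraph_bipartite: "multigraph (bipartite_mgraph t k)"
  unfolding multigraph_def
proof (intro conjI ballI)
  fix e assume "e \<in># edges (bipartite_mgraph t k)"
  then obtain u v where uv: "e = {u, v}" "u < 2 * t" "v < 2 * t" "even u" "odd v"
    using finite_bipartite_edges[of t]
    by (auto simp: bipartite_mgraph_def count_mset_set' simp flip: count_greater_zero_iff
        split: if_splits)
  then have "u \<noteq> v" by auto
  with uv show "e \<subseteq> verts (bipartite_mgraph t k)" "card e = 2" by auto
qed simp

lemma edge_mult_bipartite:
  "edge_mult (bipartite_mgraph t k) u v =
    (if u < 2 * t \<and> v < 2 * t \<and> even u \<noteq> even v then k else 0)"
proof -
  \<comment> \<open>The edge set names the even endpoint first; an unordered pair may match in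
    either order, which gives the symmetric condition.\<close>
  have "{u, v} \<in> {{u, v} | u v :: nat. u < 2 * t \<and> v < 2 * t \<and> even u \<and> odd v} \<longleftrightarrow>
      u < 2 * t \<and> v < 2 * t \<and> even u \<noteq> even v"
    by (auto simp: doubleton_eq_iff)
  then show ?thesis
    by (simp add: edge_mult_def bipartite_mgraph_def count_mset_set' finite_bipartite_edges)
qed

lemma vdegree_bipartite:
  assumes "v < 2 * t"
  shows "vdegree (bipartite_mgraph t k) v = k * t"
proof -
  have "vdegree (bipartite_mgraph t k) v =
      (\<Sum>u = 0..<2 * t. if even v \<noteq> even u then k else 0)"
    using assms by (auto simp: vdegree_def edge_mult_bipartite lessThan_atLeast0 intro!: sum.cong)
  also have "\<dots> = k * t"
    using sum_even_odd_below[of k t] by (cases "even v") simp_all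
  finally show ?thesis .
qed

lemma max_mult_bipartite:
  assumes "t > 0" "k > 0"
  shows "max_mult (bipartite_mgraph t k) = k"
proof -
  have "{edge_mult (bipartite_mgraph t k) u v | u v. u \<in> verts (bipartite_mgraph t k) \<and>
      v \<in> verts (bipartite_mgraph t k) \<and> adjacent (bipartite_mgraph t k) u v} = {k}"
    (is "?M = _")
  proof
    show "?M \<subseteq> {k}"
      by (auto simp: adjacent_def edge_mult_bipartite split: if_splits)
    \<comment> \<open>The edge joining 0 and 1 shows that the maximum is over a nonempty
      set.\<close>
    have "k = edge_mult (bipartite_mgraph t k) 0 1"
      "adjacent (bipartite_mgraph t k) 0 1" "0 < 2 * t" "1 < 2 * t"
      using assms by (simp_all add: adjacent_def edge_mult_bipartite)
    then show "{k} \<subseteq> ?M"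
      unfolding verts_bipartite by blast
  qed
  then show ?thesis by (simp add: max_mult_def)
qed

lemma vertex_list_bipartite: "i < 2 * t \<Longrightarrow> vertex_list (bipartite_mgraph t k) ! i = i"
  by (simp add: vertex_list_def lessThan_atLeast0)

lemma adj_matrix_bipartite: "adj_matrix (bipartite_mgraph t k) = parity_mat t 0 (real k)"
  by (rule eq_matI)
    (auto simp: adj_matrix_def parity_mat_def vertex_list_bipartite edge_mult_bipartite)

lemma laplacian_matrix_bipartite:
  "laplacian_matrix (bipartite_mgraph t k) = parity_mat t (real (k * t)) (- real k)"
  by (rule eq_matI)
    (auto simp: laplacian_matrix_def degree_matrix_def adj_matrix_def parity_mat_def
      vertex_list_bipartite edge_mult_bipartite vdegree_bipartite)

section \<open>Vertex-connectivity of the bipartite multigraph\<close>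

lemma adjacent_delete_verts:
  "adjacent (delete_verts G S) u v \<longleftrightarrow> adjacent G u v \<and> u \<notin> S \<and> v \<notin> S"
  by (auto simp: adjacent_def edge_mult_def delete_verts_def)

lemma adjacent_bipartite:
  "adjacent (bipartite_mgraph t k) u v \<longleftrightarrow>
    k > 0 \<and> u < 2 * t \<and> v < 2 * t \<and> even u \<noteq> even v"
  by (auto simp: adjacent_def edge_mult_bipartite)

text \<open>Fewer than \<open>t\<close> deletions cannot exhaust either part. Survivors in different
  parts are adjacent, and those in the same part are joined through a survivor of the other.\<close>

lemma connected_delete_bipartite:
  assumes "k > 0" "S \<subseteq> {..<2 * t}" "card S < t"
  shows "connected_mgraph (delete_verts (bipartite_mgraph t k) S)"
proof -
  let ?G = "delete_verts (bipartite_mgraph t k) S"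
  have fin: "finite S" using assms(2) finite_subset by blast
  have other_side: "\<exists>w. w < 2 * t \<and> w \<notin> S \<and> even w \<noteq> even u" for u :: nat
  proof (rule ccontr)
    assume "\<not> ?thesis"
    then have "{w. w < 2 * t \<and> even w \<noteq> even u} \<subseteq> S" by auto
    then have "card {w. w < 2 * t \<and> even w \<noteq> even u} \<le> card S"
      by (rule card_mono[OF fin])
    moreover have "card {w. w < 2 * t \<and> even w \<noteq> even u} = t"
      by (cases "even u") (simp_all add: card_even_odd_below)
    ultimately show False using assms(3) by simp
  qed
  have adj: "(u, v) \<in> {(x, y). adjacent ?G x y}"
    if "u < 2 * t" "v < 2 * t" "u \<notin> S" "v \<notin> S" "even u \<noteq> even v" for u v
    using that assms(1) by (simp add: adjacent_delete_verts adjacent_bipartite)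
  have "(u, v) \<in> {(x, y). adjacent ?G x y}\<^sup>*"
    if uv: "u < 2 * t" "v < 2 * t" "u \<notin> S" "v \<notin> S" for u v
  proof (cases "even u = even v")
    case True
    obtain w where w: "w < 2 * t" "w \<notin> S" "even w \<noteq> even u" using other_side by blast
    have "(u, w) \<in> {(x, y). adjacent ?G x y}" "(w, v) \<in> {(x, y). adjacent ?G x y}"
      using w uv True by (intro adj; simp)+
    then show ?thesis by (meson r_into_rtrancl rtrancl_trans)
  next
    case False
    then show ?thesis using adj uv by blast
  qed
  then show ?thesis
    by (auto simp: connected_mgraph_def delete_verts_def)
qed

lemma not_connected_delete_even_bipartite:
  assumes "t \<ge> 2"
  shows "\<not> connected_mgraph (delete_verts (bipartite_mgraph t k) {i. i < 2 * t \<and> even i})"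
    (is "\<not> connected_mgraph ?G")
proof
  assume "connected_mgraph ?G"
  \<comment> \<open>Two odd vertices exist because \<open>t \<ge> 2\<close>; with no edges left,
    neither reaches the other.\<close>
  moreover have "1 \<in> verts ?G" "3 \<in> verts ?G"
    using assms by (auto simp: delete_verts_def)
  ultimately have "(1, 3) \<in> {(x, y). adjacent ?G x y}\<^sup>*"
    by (auto simp: connected_mgraph_def)
  moreover have "{(x, y). adjacent ?G x y} = {}"
    by (auto simp: adjacent_delete_verts adjacent_bipartite)
  ultimately show False by simp
qed

lemma vertex_connectivity_bipartite:
  assumes "t \<ge> 2" "k > 0"
  shows "vertex_connectivity (bipartite_mgraph t k) = t"
proof -
  have "vertex_connected l (bipartite_mgraph t k) \<longleftrightarrow> l \<le> t" for l
  proof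
    assume conn: "vertex_connected l (bipartite_mgraph t k)"
    show "l \<le> t"
    proof (rule ccontr)
      assume "\<not> l \<le> t"
      then have "card {i. i < 2 * t \<and> even i} < l" by (simp add: card_even_odd_below)
      moreover have "{i. i < 2 * t \<and> even i} \<subseteq> verts (bipartite_mgraph t k)" by auto
      ultimately show False
        using conn not_connected_delete_even_bipartite[OF assms(1), of k]
        unfolding vertex_connected_def by blast
    qed
  next
    assume "l \<le> t"
    then show "vertex_connected l (bipartite_mgraph t k)"
      using assms by (auto simp: vertex_connected_def intro!: connected_delete_bipartite)
  qed
  \<comment> \<open>The admissible values form a finite initial segment, so \<open>Max\<close>
    returns its top element \<open>t\<close>.\<close>
  then have "{l. vertex_connected l (bipartite_mgraph t k)} = {..t}" by auto
  then show ?thesis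
    by (simp add: vertex_connectivity_def Max_eq_iff)
qed

theorem mainTheorem3:
  fixes t :: nat
  assumes "t \<ge> 2"
  shows "infinite {d :: nat. d > 0 \<and>
    (\<exists>H :: nat mgraph. multigraph H \<and> regular d H \<and>
       adj_eigenvalue 2 H = 0 \<and> laplacian_eigenvalue 2 H = real d \<and>
       vertex_connectivity H = t \<and> real (max_mult H) = real d / real t)}"
    (is "infinite ?D")
proof -
  \<comment> \<open>Every multiplicity \<open>k > 0\<close> realises the degree
    \<open>k * t\<close>; distinct \<open>k\<close> give distinct degrees, hence infinitely
    many.\<close>
  have "k * t \<in> ?D" if "k > 0" for k
  proof -
    have "adj_eigenvalue 2 (bipartite_mgraph t k) = 0"
      "laplacian_eigenvalue 2 (bipartite_mgraph t k) = real (k * t)"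
      using second_eigenvalues_parity_mat[OF assms]
      by (simp_all add: adj_eigenvalue_def laplacian_eigenvalue_def adj_matrix_bipartite
          laplacian_matrix_bipartite)
    moreover have "regular (k * t) (bipartite_mgraph t k)"
      by (simp add: regular_def vdegree_bipartite)
    moreover have "real (max_mult (bipartite_mgraph t k)) = real (k * t) / real t"
      using assms that by (simp add: max_mult_bipartite)
    ultimately show ?thesis
      using assms that multigraph_bipartite vertex_connectivity_bipartite[OF assms that]
      by (intro CollectI conjI exI[of _ "bipartite_mgraph t k"]) simp_all
  qed
  then have "(\<lambda>k. k * t) ` {0<..} \<subseteq> ?D" by blast
  moreover have "infinite ((\<lambda>k. k * t) ` {0<..})"
    using assms by (subst finite_image_iff) (auto simp: inj_on_def infinite_Ioi)
  ultimately show ?thesis by (rule infinite_super)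
qed

end
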